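(* Let $(X,d)$ be a metric space and let $C(X)$ be the collection of nonempty closed subsets of $X$. Let $\tau_{lf}$ be the locally finite topology and $\tau_H$ the Hausdorff metric topology on $C(X)$. Then $\tau_{lf}\subset\tau_H$ if and only if each nonempty closed subset of $X$ has the property $I$.
   Context: For $A\subset X$, $A^+=\{C\in C(X):C\subset A\}$; for a family $\mathcal U$ of nonempty subsets of $X$, $\mathcal U^-=\{C\in C(X):C\cap U\neq\emptyset\ \text{for all } U\in\mathcal U\}$. The upper locally finite topology $\tau_{lf^+}$ on $C(X)$ has as a subbase all $U^+$ with $U$ open in $X$; the lower locally finite topology $\tau_{lf^-}$ has as a subbase all $\mathcal U^-$ with $\mathcal U$ a locally finite collection of (nonempty) open subsets of $X$. The locally finite topology is $\tau_{lf}=\tau_{lf^-}\lor\tau_{lf^+}$ (supremum of the two topologies). The topology $\tau_H$ is induced by the Hausdorff metric $H(A,B)=\max\{\sup_{x\in A}d(x,B),\ \sup_{x\in B}d(x,A)\}$ on $C(X)$ (which may take the value $+\infty$). A nonempty subset $A$ of $X$ has the property $I$ if for each open $U\subset X$ with $A\subset U$, $\inf\{d(a,U^c):a\in A\}>0$, where $U^c=X\setminus U$ and $d(a,\emptyset)=+\infty$. *)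

theory Defs
  imports "HOL-Analysis.Analysis"
begin

definition closed_hyperspace :: "'a topology \<Rightarrow> 'a set set" where
  "closed_hyperspace X = {C. closedin X C \<and> C \<noteq> {}}"

definition hyper_upper :: "'a topology \<Rightarrow> 'a set \<Rightarrow> 'a set set" where
  "hyper_upper X A = {C \<in> closed_hyperspace X. C \<subseteq> A}"

definition hyper_lower :: "'a topology \<Rightarrow> 'a set set \<Rightarrow> 'a set set" where
  "hyper_lower X \<U> = {C \<in> closed_hyperspace X. \<forall>U\<in>\<U>. C \<inter> U \<noteq> {}}"

definition upper_lf_topology :: "'a topology \<Rightarrow> 'a set topology" where
  "upper_lf_topology X = topology_generated_by {hyper_upper X U |U. openin X U}"

definition lower_lf_topology :: "'a topology \<Rightarrow> 'a set topology" where
  "lower_lf_topology X = topology_generated_by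
     {hyper_lower X \<U> |\<U>. locally_finite_in X \<U> \<and> (\<forall>U\<in>\<U>. openin X U \<and> U \<noteq> {})}"

definition locally_finite_topology :: "'a topology \<Rightarrow> 'a set topology" where
  "locally_finite_topology X = topology_generated_by
     (Collect (openin (lower_lf_topology X)) \<union> Collect (openin (upper_lf_topology X)))"

text \<open>The underlying sets of these topologies are all of the hyperspace, because the subbases
  contain \<open>hyper_upper X (topspace X)\<close> and \<open>hyper_lower X {}\<close>.\<close>

lemma topspace_upper_lf_topology: "topspace (upper_lf_topology X) = closed_hyperspace X"
proof -
  have "closed_hyperspace X = hyper_upper X (topspace X)"
    by (auto simp: hyper_upper_def closed_hyperspace_def dest: closedin_subset)
  then show ?thesis
    unfolding upper_lf_topology_def topology_generated_by_topspace
    by (auto simp: hyper_upper_def)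
qed

lemma topspace_lower_lf_topology: "topspace (lower_lf_topology X) = closed_hyperspace X"
proof -
  have "closed_hyperspace X = hyper_lower X {}" "locally_finite_in X {}"
    by (auto simp: hyper_lower_def locally_finite_in_def)
  then show ?thesis
    unfolding lower_lf_topology_def topology_generated_by_topspace
    by (fastforce simp: hyper_lower_def)
qed

lemma topspace_locally_finite_topology:
  "topspace (locally_finite_topology X) = closed_hyperspace X"
  unfolding locally_finite_topology_def topology_generated_by_topspace
  using topspace_upper_lf_topology[of X] topspace_lower_lf_topology[of X]
  by (auto simp: topspace_def)

context Metric_space
begin

text \<open>Distances to sets are extended reals, so that the distance to the empty set is
  \<open>Inf {} = \<infinity>\<close> and the Hausdorff distance of unbounded sets may be infinite.\<close>

definition point_set_dist :: "'a \<Rightarrow> 'a set \<Rightarrow> ereal" where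
  "point_set_dist x A = (INF a\<in>A. ereal (d x a))"

definition hausdorff_dist :: "'a set \<Rightarrow> 'a set \<Rightarrow> ereal" where
  "hausdorff_dist A B = max (SUP x\<in>A. point_set_dist x B) (SUP x\<in>B. point_set_dist x A)"

definition hausdorff_topology :: "'a set topology" where
  "hausdorff_topology = topology (\<lambda>W. W \<subseteq> closed_hyperspace mtopology \<and>
     (\<forall>A\<in>W. \<exists>\<epsilon>>0. \<forall>B\<in>closed_hyperspace mtopology. hausdorff_dist A B < \<epsilon> \<longrightarrow> B \<in> W))"

lemma openin_hausdorff_topology:
  "openin hausdorff_topology W \<longleftrightarrow> W \<subseteq> closed_hyperspace mtopology \<and>
     (\<forall>A\<in>W. \<exists>\<epsilon>>0. \<forall>B\<in>closed_hyperspace mtopology. hausdorff_dist A B < \<epsilon> \<longrightarrow> B \<in> W)"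
proof -
  let ?P = "\<lambda>W. W \<subseteq> closed_hyperspace mtopology \<and>
     (\<forall>A\<in>W. \<exists>\<epsilon>>0. \<forall>B\<in>closed_hyperspace mtopology. hausdorff_dist A B < \<epsilon> \<longrightarrow> B \<in> W)"
  have 1: "?P (S \<inter> T)" if S: "?P S" and T: "?P T" for S T
  proof (intro conjI ballI)
    fix A assume A: "A \<in> S \<inter> T"
    obtain e1 where e1: "e1 > 0"
      "\<forall>B\<in>closed_hyperspace mtopology. hausdorff_dist A B < e1 \<longrightarrow> B \<in> S" using S A by blast
    obtain e2 where e2: "e2 > 0"
      "\<forall>B\<in>closed_hyperspace mtopology. hausdorff_dist A B < e2 \<longrightarrow> B \<in> T" using T A by blast
    show "\<exists>\<epsilon>>0. \<forall>B\<in>closed_hyperspace mtopology. hausdorff_dist A B < \<epsilon> \<longrightarrow> B \<in> S \<inter> T"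
      using e1 e2 by (intro exI[of _ "min e1 e2"]) auto
  qed (use S in blast)
  have 2: "?P (\<Union>\<K>)" if K: "\<forall>K\<in>\<K>. ?P K" for \<K>
  proof (intro conjI ballI)
    fix A assume "A \<in> \<Union>\<K>"
    then obtain K e where "K \<in> \<K>" "e > 0"
      "\<forall>B\<in>closed_hyperspace mtopology. hausdorff_dist A B < e \<longrightarrow> B \<in> K" using K by blast
    then show "\<exists>\<epsilon>>0. \<forall>B\<in>closed_hyperspace mtopology. hausdorff_dist A B < \<epsilon> \<longrightarrow> B \<in> \<Union>\<K>"
      by (intro exI[of _ e]) auto
  qed (use K in blast)
  have "istopology ?P"
    unfolding istopology_def using 1 2 by (intro conjI[OF allI allI] allI impI) simp_all
  then show ?thesis
    by (simp add: hausdorff_topology_def topology_inverse')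
qed

definition property_I :: "'a set \<Rightarrow> bool" where
  "property_I A \<longleftrightarrow> A \<subseteq> M \<and> A \<noteq> {} \<and>
     (\<forall>U. openin mtopology U \<and> A \<subseteq> U \<longrightarrow> (INF a\<in>A. point_set_dist a (M - U)) > 0)"

end

end

theory Submission
  imports Defs
begin

text \<open>
  If \<open>\<tau>\<^sub>l\<^sub>f \<subseteq> \<tau>\<^sub>H\<close>, a Hausdorff ball around \<open>A\<close> lies in \<open>U\<^sup>+\<close>, and testing it on the sets
  \<open>A \<union> {y}\<close> bounds \<open>d(A, U\<^sup>c)\<close> from below. Conversely, property \<open>I\<close> at once makes \<open>U\<^sup>+\<close> Hausdorff
  open. For \<open>\<U>\<^sup>-\<close> pick \<open>x\<^sub>U \<in> A \<inter> U\<close> for each \<open>U \<in> \<U>\<close>; a uniform lower bound for the distances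
  \<open>d(x\<^sub>U, U\<^sup>c)\<close> is needed. If there is none, local finiteness lets us extract pairs \<open>(x\<^sub>n, y\<^sub>n)\<close> with
  \<open>d(x\<^sub>n, y\<^sub>n) \<rightarrow> 0\<close> such that \<open>{x\<^sub>n}\<close> and \<open>{y\<^sub>n}\<close> are disjoint closed sets, so that \<open>{x\<^sub>n}\<close> fails
  property \<open>I\<close> in the complement of \<open>{y\<^sub>n}\<close>.
\<close>

section \<open>Reduction to subbasic sets\<close>

lemma openin_topology_generated_by_subset:
  assumes "\<And>S. S \<in> \<S> \<Longrightarrow> openin T S" and "openin (topology_generated_by \<S>) W"
  shows "openin T W"
  using generate_topology_on_coarsest[of "openin T" \<S> W] assms
  by (simp add: openin_topology_generated_by_iff)

text \<open>A join of two topologies is coarser than \<open>T\<close> exactly when both are, and a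
  generated topology is coarser than \<open>T\<close> exactly when its generators are open in
  \<open>T\<close>.\<close>

lemma openin_locally_finite_topology_subset_iff:
  "(\<forall>W. openin (locally_finite_topology X) W \<longrightarrow> openin T W) \<longleftrightarrow>
   (\<forall>U. openin X U \<longrightarrow> openin T (hyper_upper X U)) \<and>
   (\<forall>\<U>. locally_finite_in X \<U> \<and> (\<forall>U\<in>\<U>. openin X U \<and> U \<noteq> {}) \<longrightarrow> openin T (hyper_lower X \<U>))"
  (is "?lhs \<longleftrightarrow> ?rhs")
proof
  assume L: ?lhs
  have "openin (locally_finite_topology X) (hyper_upper X U)" if "openin X U" for U
  proof -
    have "openin (upper_lf_topology X) (hyper_upper X U)"
      unfolding upper_lf_topology_def using that by (intro topology_generated_by_Basis) blast
    then show ?thesis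
      unfolding locally_finite_topology_def by (intro topology_generated_by_Basis) blast
  qed
  moreover have "openin (locally_finite_topology X) (hyper_lower X \<U>)"
    if "locally_finite_in X \<U> \<and> (\<forall>U\<in>\<U>. openin X U \<and> U \<noteq> {})" for \<U>
  proof -
    have "openin (lower_lf_topology X) (hyper_lower X \<U>)"
      unfolding lower_lf_topology_def using that by (intro topology_generated_by_Basis) blast
    then show ?thesis
      unfolding locally_finite_topology_def by (intro topology_generated_by_Basis) blast
  qed
  ultimately show ?rhs using L by blast
next
  assume R: ?rhs
  have "openin T W" if "openin (lower_lf_topology X) W" for W
    using that R unfolding lower_lf_topology_def
    by (elim openin_topology_generated_by_subset[rotated]) blast
  moreover have "openin T W" if "openin (upper_lf_topology X) W" for W
    using that R unfolding upper_lf_topology_def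
    by (elim openin_topology_generated_by_subset[rotated]) blast
  ultimately show ?lhs
    unfolding locally_finite_topology_def
    by (intro allI impI, elim openin_topology_generated_by_subset[rotated]) blast
qed

context Metric_space
begin

section \<open>From extended distances to real bounds\<close>

lemma point_set_dist_lessE:
  assumes "point_set_dist x A < e"
  obtains a where "a \<in> A" "ereal (d x a) < e"
  using assms unfolding point_set_dist_def INF_less_iff by blast

lemma point_set_dist_le: "a \<in> A \<Longrightarrow> point_set_dist x A \<le> ereal (d x a)"
  unfolding point_set_dist_def by (rule INF_lower)

lemma hausdorff_dist_lessD:
  assumes "hausdorff_dist A B < e"
  shows "x \<in> A \<Longrightarrow> point_set_dist x B < e" and "y \<in> B \<Longrightarrow> point_set_dist y A < e"
proof -
  have *: "(SUP x\<in>A. point_set_dist x B) < e" "(SUP x\<in>B. point_set_dist x A) < e"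
    using assms unfolding hausdorff_dist_def by auto
  show "x \<in> A \<Longrightarrow> point_set_dist x B < e" "y \<in> B \<Longrightarrow> point_set_dist y A < e"
    using *[THEN order.strict_trans1[rotated]] by (auto intro: SUP_upper)
qed

lemma property_I_iff:
  "property_I A \<longleftrightarrow> A \<subseteq> M \<and> A \<noteq> {} \<and>
     (\<forall>U. openin mtopology U \<and> A \<subseteq> U \<longrightarrow> (\<exists>e>0. \<forall>a\<in>A. \<forall>y\<in>M - U. e \<le> d a y))"
proof -
  have "(INF a\<in>A. point_set_dist a (M - U)) > 0 \<longleftrightarrow> (\<exists>e>0. \<forall>a\<in>A. \<forall>y\<in>M - U. e \<le> d a y)"
    (is "?l \<longleftrightarrow> ?r") for U
  proof
    assume ?l
    \<comment> \<open>The infimum is \<infinity> when \<open>M - U\<close> is empty, so a real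
      number below it is interpolated.\<close>
    then obtain e where e: "0 < ereal e" "ereal e < (INF a\<in>A. point_set_dist a (M - U))"
      using ereal_dense2 by blast
    have "e \<le> d a y" if "a \<in> A" "y \<in> M - U" for a y
    proof -
      have "ereal e < point_set_dist a (M - U)"
        using e(2) that(1) by (meson INF_lower order.strict_trans2)
      also have "\<dots> \<le> ereal (d a y)" by (rule point_set_dist_le[OF that(2)])
      finally show ?thesis by simp
    qed
    with e(1) show ?r by auto
  next
    assume ?r
    then obtain e where e: "e > 0" "\<forall>a\<in>A. \<forall>y\<in>M - U. e \<le> d a y" by blast
    have "ereal e \<le> (INF a\<in>A. point_set_dist a (M - U))"
      unfolding point_set_dist_def using e(2) by (intro INF_greatest) auto
    with e(1) show ?l by (meson ereal_less(2) order.strict_trans2)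
  qed
  then show ?thesis unfolding property_I_def by simp
qed

lemma property_I_gap:
  assumes "property_I A" "openin mtopology U" "A \<subseteq> U"
  obtains e where "e > 0" "\<And>a y. a \<in> A \<Longrightarrow> y \<in> M - U \<Longrightarrow> e \<le> d a y"
  using assms unfolding property_I_iff by meson

section \<open>Upper sets and property I\<close>

lemma property_I_if_hyper_upper_open:
  assumes "\<And>U. openin mtopology U \<Longrightarrow> openin hausdorff_topology (hyper_upper mtopology U)"
    and A: "closedin mtopology A" "A \<noteq> {}"
  shows "property_I A"
  unfolding property_I_iff
proof (intro conjI allI impI)
  show AM: "A \<subseteq> M" using closedin_subset[OF A(1)] by simp
  fix U assume U: "openin mtopology U \<and> A \<subseteq> U"
  then have "A \<in> hyper_upper mtopology U"
    using A by (simp add: hyper_upper_def closed_hyperspace_def)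
  then obtain \<epsilon> :: ereal where \<epsilon>: "\<epsilon> > 0"
    "\<And>B. B \<in> closed_hyperspace mtopology \<Longrightarrow> hausdorff_dist A B < \<epsilon> \<Longrightarrow> B \<in> hyper_upper mtopology U"
    using assms(1)[of U] U unfolding openin_hausdorff_topology by blast
  \<comment> \<open>\<open>\<epsilon>\<close> may be infinite, and the suprema in
    \<open>hausdorff_dist\<close> will only be bounded by \<le> \<open>e\<close>; a real
    \<open>e\<close> strictly below \<open>\<epsilon>\<close> handles both.\<close>
  then obtain e where e: "0 < ereal e" "ereal e < \<epsilon>" using ereal_dense2 by blast
  have "e \<le> d a y" if ay: "a \<in> A" "y \<in> M - U" for a y
  proof (rule ccontr)
    assume "\<not> e \<le> d a y"
    \<comment> \<open>Only \<open>y\<close> contributes to the Hausdorff distance from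
      \<open>A\<close>, and at most \<open>d a y\<close>, so \<open>?B\<close> stays in the ball
      although \<open>y\<close> is outside \<open>U\<close>.\<close>
    let ?B = "insert y A"
    have self: "point_set_dist x S \<le> ereal e" if "x \<in> S" "x \<in> M" for x S
      using order_trans[OF point_set_dist_le[OF that(1), of x], of "ereal e"] that(2) e(1) by simp
    have "point_set_dist x ?B \<le> ereal e" if "x \<in> A" for x
      using self that AM by blast
    moreover have "point_set_dist y A \<le> ereal e"
      using order_trans[OF point_set_dist_le[OF ay(1), of y], of "ereal e"] \<open>\<not> e \<le> d a y\<close>
      by (simp add: commute)
    then have "point_set_dist x A \<le> ereal e" if "x \<in> ?B" for x
      using self[of x A] that AM by blast
    ultimately have "hausdorff_dist A ?B \<le> ereal e"
      unfolding hausdorff_dist_def by (auto intro!: SUP_least)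
    with e(2) have "hausdorff_dist A ?B < \<epsilon>" by simp
    moreover have "closedin mtopology ?B"
      using closedin_Un[OF closedin_t1_singleton A(1), of y] ay
      by (simp add: Hausdorff_imp_t1_space Hausdorff_space_mtopology)
    ultimately have "?B \<in> hyper_upper mtopology U"
      by (intro \<epsilon>(2)) (auto simp: closed_hyperspace_def)
    then show False using ay by (auto simp: hyper_upper_def)
  qed
  then show "\<exists>e>0. \<forall>a\<in>A. \<forall>y\<in>M - U. e \<le> d a y" using e(1) by auto
qed (use A in blast)

text \<open>The gap between \<open>A\<close> and the complement of \<open>U\<close> serves as
  Hausdorff radius: a point closer than that to some point of \<open>A\<close> cannot leave
  \<open>U\<close>.\<close>

lemma hyper_upper_open_if_property_I:
  assumes I: "\<And>A. closedin mtopology A \<Longrightarrow> A \<noteq> {} \<Longrightarrow> property_I A"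
    and U: "openin mtopology U"
  shows "openin hausdorff_topology (hyper_upper mtopology U)"
  unfolding openin_hausdorff_topology
proof (intro conjI ballI)
  fix A assume A: "A \<in> hyper_upper mtopology U"
  then have "property_I A" "A \<subseteq> U" using I by (auto simp: hyper_upper_def closed_hyperspace_def)
  then obtain e where e: "e > 0" "\<And>a y. a \<in> A \<Longrightarrow> y \<in> M - U \<Longrightarrow> e \<le> d a y"
    using property_I_gap[OF _ U] by metis
  have "B \<in> hyper_upper mtopology U"
    if B: "B \<in> closed_hyperspace mtopology" "hausdorff_dist A B < ereal e" for B
  proof -
    have "y \<in> U" if "y \<in> B" for y
    proof (rule ccontr)
      assume "y \<notin> U"
      have "y \<in> M" using B(1) that closedin_subset by (fastforce simp: closed_hyperspace_def)
      moreover obtain a where "a \<in> A" "ereal (d y a) < ereal e"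
        using point_set_dist_lessE[OF hausdorff_dist_lessD(2)[OF B(2) \<open>y \<in> B\<close>]] .
      ultimately show False using e(2)[of a y] \<open>y \<notin> U\<close> by (simp add: commute)
    qed
    then show ?thesis using B(1) by (auto simp: hyper_upper_def)
  qed
  then show "\<exists>\<epsilon>>0. \<forall>B\<in>closed_hyperspace mtopology. hausdorff_dist A B < \<epsilon> \<longrightarrow> B \<in> hyper_upper mtopology U"
    using e(1) by (intro exI[of _ "ereal e"]) auto
qed (auto simp: hyper_upper_def)

section \<open>Gaps of families of pairs, and lower sets\<close>

lemma closedin_range_if_eventually_far:
  fixes f :: "nat \<Rightarrow> 'a"
  assumes f: "range f \<subseteq> M"
    and far: "\<And>p. p \<in> M \<Longrightarrow> \<exists>e>0. \<exists>N. \<forall>n\<ge>N. e \<le> d (f n) p"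
  shows "closedin mtopology (range f)"
  unfolding closedin_metric
proof (intro conjI allI impI)
  fix p assume p: "p \<in> M - range f"
  then obtain e N where e: "e > 0" "\<And>n. n \<ge> N \<Longrightarrow> e \<le> d (f n) p" using far by blast
  \<comment> \<open>The bound \<open>e\<close> covers all indices from \<open>N\<close> on; the
    finitely many earlier distances are positive because \<open>p\<close> is not in the
    range.\<close>
  define r where "r = Min (insert e ((\<lambda>n. d (f n) p) ` {..<N}))"
  have "d (f n) p > 0" for n using p f by (metis DiffE mdist_pos_less rangeI subsetD)
  then have "r > 0" using e(1) by (auto simp: r_def)
  moreover have "r \<le> d (f n) p" for n
  proof (cases "n < N")
    case False
    then have "e \<le> d (f n) p" by (intro e(2)) simp
    then show ?thesis unfolding r_def by (auto intro: Min.coboundedI order_trans)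
  qed (auto simp: r_def)
  ultimately show "\<exists>r>0. disjnt (range f) (mball p r)"
    by (intro exI[of _ r]) (auto simp: disjnt_iff commute not_less)
qed (rule f)

text \<open>The hypothesis \<open>far\<close> is the form in which local finiteness enters: short
  pairs cannot accumulate at any point of \<open>M\<close>.\<close>

lemma property_I_imp_positive_gap:
  assumes I: "\<And>A. closedin mtopology A \<Longrightarrow> A \<noteq> {} \<Longrightarrow> property_I A"
    and P: "P \<subseteq> M \<times> M"
    and far: "\<And>p. p \<in> M \<Longrightarrow> \<exists>e>0. \<forall>(x, y)\<in>P. d x y < e \<longrightarrow> e \<le> d x p \<and> e \<le> d y p"
  shows "\<exists>e>0. \<forall>(x, y)\<in>P. e \<le> d x y"
proof (rule ccontr)
  assume "\<not> ?thesis"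
  then have small: "\<exists>(x, y)\<in>P. d x y < e" if "e > 0" for e
    using that by (force simp: not_le)
  obtain g where g: "\<And>p. p \<in> M \<Longrightarrow> g p > 0"
    "\<And>p x y. \<lbrakk>p \<in> M; (x, y) \<in> P; d x y < g p\<rbrakk> \<Longrightarrow> g p \<le> d x p \<and> g p \<le> d y p"
    using far by (metis (no_types, lifting) case_prodD)
  \<comment> \<open>The \<open>n\<close>-th pair avoids the opposite coordinates of all earlier
    pairs, which will make the two ranges disjoint.\<close>
  let ?Q = "\<lambda>s n r. r \<in> P \<and> d (fst r) (snd r) < 1 / real (Suc n) \<and>
    (\<forall>m<n. fst r \<noteq> snd (s m) \<and> snd r \<noteq> fst (s m))"
  have "\<exists>s. \<forall>n. ?Q s n (s n)"
  proof (rule dependent_wellorder_choice)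
    fix n and s :: "nat \<Rightarrow> 'a \<times> 'a"
    assume prev: "\<And>m. m < n \<Longrightarrow> ?Q s m (s m)"
    define F where "F = fst ` s ` {..<n} \<union> snd ` s ` {..<n}"
    have F: "finite F" "F \<subseteq> M" using prev P by (fastforce simp: F_def)+
    \<comment> \<open>\<open>F\<close> holds the coordinates chosen so far. A pair shorter than
      \<open>g p\<close> keeps a positive distance from \<open>p\<close>, so one shorter than
      \<open>e\<close> avoids all of \<open>F\<close>.\<close>
    define e where "e = Min (insert (1 / real (Suc n)) (g ` F))"
    have "e > 0" using F g(1) by (auto simp: e_def)
    then obtain x y where xy: "(x, y) \<in> P" "d x y < e" using small by blast
    have "x \<noteq> p \<and> y \<noteq> p" if "p \<in> F" for p
    proof -
      have "p \<in> M" "e \<le> g p" using F that by (auto simp: e_def)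
      then show ?thesis using g[of p] xy by (metis mdist_zero order.strict_trans2 not_le)
    qed
    moreover have "d x y < 1 / real (Suc n)"
      using xy(2) F(1) by (simp add: e_def)
    ultimately show "\<exists>r. ?Q s n r"
      using xy(1) by (intro exI[of _ "(x, y)"]) (auto simp: F_def)
  qed auto
  then obtain s where s: "\<And>n. ?Q s n (s n)" by blast
  define x where "x n = fst (s n)" for n
  define y where "y n = snd (s n)" for n
  have xyP: "(x n, y n) \<in> P" for n using s[of n] by (simp add: x_def y_def)
  then have xyM: "range x \<subseteq> M" "range y \<subseteq> M" using P by blast+
  have lim: "\<exists>N. \<forall>n\<ge>N. d (x n) (y n) < e" if "e > 0" for e
  proof -
    obtain N where N: "inverse (real (Suc N)) < e" using reals_Archimedean[OF \<open>e > 0\<close>] by blast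
    have "d (x n) (y n) < e" if "n \<ge> N" for n
    proof -
      have "d (x n) (y n) < 1 / real (Suc n)" using s[of n] by (simp add: x_def y_def)
      also have "\<dots> \<le> inverse (real (Suc N))" using that by (simp add: field_simps)
      finally show ?thesis using N by simp
    qed
    then show ?thesis by blast
  qed
  \<comment> \<open>Pairs of large index are shorter than \<open>g p\<close>, so neither coordinate
    sequence accumulates at \<open>p\<close>; hence both ranges are closed.\<close>
  have far': "\<exists>N. \<forall>n\<ge>N. g p \<le> d (x n) p \<and> g p \<le> d (y n) p" if "p \<in> M" for p
    using lim[OF g(1)[OF that]] g(2)[OF that xyP] by blast
  have "closedin mtopology (range z)" if "z \<in> {x, y}" for z
  proof (rule closedin_range_if_eventually_far)
    fix p assume "p \<in> M"
    then show "\<exists>e>0. \<exists>N. \<forall>n\<ge>N. e \<le> d (z n) p"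
      using far'[of p] g(1)[of p] that by (intro exI[of _ "g p"]) auto
  qed (use that xyM in auto)
  then have cl: "closedin mtopology (range x)" "closedin mtopology (range y)" by simp_all
  \<comment> \<open>For different indices the later pair avoids the earlier one. For equal indices,
    a pair of length 0 would violate \<open>far\<close> at \<open>p = x n\<close>.\<close>
  have "x m \<noteq> y n" for m n
  proof (cases m n rule: linorder_cases)
    case less
    then show ?thesis using s[of n] by (auto simp: x_def y_def)
  next
    case equal
    have "x n \<in> M" using xyM by blast
    then show ?thesis using g[of "x n"] xyP[of n] equal
      by (metis mdist_zero not_le)
  next
    case greater
    then show ?thesis using s[of m] by (auto simp: x_def y_def)
  qed
  then have "range x \<subseteq> M - range y" using xyM by auto
  moreover have "openin mtopology (M - range y)" using cl(2) by (simp add: closedin_def)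
  moreover have "property_I (range x)" using cl(1) by (intro I) auto
  ultimately obtain e where e: "e > 0" "\<And>m y'. y' \<in> M - (M - range y) \<Longrightarrow> e \<le> d (x m) y'"
    by (metis property_I_gap rangeI)
  obtain N where "d (x N) (y N) < e" using lim[OF e(1)] by blast
  moreover have "e \<le> d (x N) (y N)" using xyM by (intro e(2)) auto
  ultimately show False by simp
qed

text \<open>A common lower bound \<open>e\<close> for the distances from \<open>c U\<close> to the
  complements of \<open>U\<close> serves as radius: a set within \<open>e\<close> of
  \<open>A\<close> has a point closer than \<open>e\<close> to \<open>c U\<close>, and that point
  lies in \<open>U\<close>.\<close>

lemma hyper_lower_open_if_property_I:
  assumes I: "\<And>A. closedin mtopology A \<Longrightarrow> A \<noteq> {} \<Longrightarrow> property_I A"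
    and lf: "locally_finite_in mtopology \<U>"
    and op: "\<And>U. U \<in> \<U> \<Longrightarrow> openin mtopology U"
  shows "openin hausdorff_topology (hyper_lower mtopology \<U>)"
  unfolding openin_hausdorff_topology
proof (intro conjI ballI)
  fix A assume A: "A \<in> hyper_lower mtopology \<U>"
  then have "\<forall>U\<in>\<U>. \<exists>x. x \<in> A \<inter> U" by (auto simp: hyper_lower_def)
  from bchoice[OF this] obtain c where c: "\<And>U. U \<in> \<U> \<Longrightarrow> c U \<in> A \<inter> U" by blast
  have cM: "c U \<in> M" if "U \<in> \<U>" for U using c[OF that] op[OF that] openin_subset by fastforce
  have "\<exists>r>0. mball (c U) r \<subseteq> U" if "U \<in> \<U>" for U
    using op[OF that] c[OF that] by (auto simp: openin_mtopology)
  then obtain \<rho> where \<rho>: "\<And>U. U \<in> \<U> \<Longrightarrow> \<rho> U > 0" "\<And>U. U \<in> \<U> \<Longrightarrow> mball (c U) (\<rho> U) \<subseteq> U"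
    by metis
  \<comment> \<open>A member \<open>U = M\<close> yields no pair, in accordance with infinite
    distance to the empty set.\<close>
  define P where "P = {(c U, y) |U y. U \<in> \<U> \<and> y \<in> M - U}"
  have "\<exists>e>0. \<forall>(x, y)\<in>P. e \<le> d x y"
  proof (rule property_I_imp_positive_gap[OF I])
    show "P \<subseteq> M \<times> M" using cM by (auto simp: P_def)
    fix p assume p: "p \<in> M"
    then obtain V where V: "openin mtopology V" "p \<in> V" "finite {U \<in> \<U>. U \<inter> V \<noteq> {}}"
      using lf by (auto simp: locally_finite_in_def)
    then obtain r where r: "r > 0" "mball p r \<subseteq> V" by (auto simp: openin_mtopology)
    \<comment> \<open>If \<open>c U\<close> were closer than \<open>r\<close> to \<open>p\<close>,
      then \<open>U\<close> would be one of the finitely many members meeting \<open>V\<close>, and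
      a pair shorter than \<open>\<rho> U\<close> would have \<open>y\<close> in \<open>U\<close>.
      The half of \<open>r\<close> leaves room for \<open>y\<close> in the triangle
      inequality.\<close>
    define e where "e = Min (insert (r / 2) (\<rho> ` {U \<in> \<U>. U \<inter> V \<noteq> {}}))"
    have "e > 0" using V(3) r(1) \<rho>(1) by (auto simp: e_def)
    moreover have "e \<le> d (c U) p \<and> e \<le> d y p" if U: "U \<in> \<U>" "y \<in> M - U" "d (c U) y < e" for U y
    proof -
      have "r \<le> d (c U) p"
      proof (rule ccontr)
        assume "\<not> r \<le> d (c U) p"
        then have "c U \<in> V" using r(2) p cM[OF U(1)] by (auto simp: commute)
        then have "U \<inter> V \<noteq> {}" using c[OF U(1)] by blast
        then have "e \<le> \<rho> U" using V(3) U(1) by (auto simp: e_def)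
        then have "y \<in> mball (c U) (\<rho> U)" using U cM by auto
        then show False using \<rho>(2) U by blast
      qed
      moreover have "d (c U) p \<le> d (c U) y + d y p" using U p cM by (intro triangle) auto
      moreover have "e \<le> r / 2" using V(3) unfolding e_def by (intro Min_le) auto
      ultimately show ?thesis using U(3) r(1) by linarith
    qed
    ultimately show "\<exists>e>0. \<forall>(x, y)\<in>P. d x y < e \<longrightarrow> e \<le> d x p \<and> e \<le> d y p"
      by (auto simp: P_def)
  qed
  then obtain e where e: "e > 0" "\<And>U y. U \<in> \<U> \<Longrightarrow> y \<in> M - U \<Longrightarrow> e \<le> d (c U) y"
    unfolding P_def by blast
  have "B \<in> hyper_lower mtopology \<U>"
    if B: "B \<in> closed_hyperspace mtopology" "hausdorff_dist A B < ereal e" for B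
  proof -
    have "B \<inter> U \<noteq> {}" if U: "U \<in> \<U>" for U
    proof -
      obtain b where b: "b \<in> B" "ereal (d (c U) b) < ereal e"
        using point_set_dist_lessE[OF hausdorff_dist_lessD(1)[OF B(2)]] c[OF U] by blast
      moreover have "b \<in> M" using B(1) b(1) closedin_subset by (fastforce simp: closed_hyperspace_def)
      ultimately show ?thesis using e(2)[OF U, of b] by fastforce
    qed
    then show ?thesis using B(1) by (simp add: hyper_lower_def)
  qed
  then show "\<exists>\<epsilon>>0. \<forall>B\<in>closed_hyperspace mtopology. hausdorff_dist A B < \<epsilon> \<longrightarrow> B \<in> hyper_lower mtopology \<U>"
    using e(1) by (intro exI[of _ "ereal e"]) auto
qed (auto simp: hyper_lower_def)

end

theorem theorem5p2:
  fixes X :: "'a set" and d :: "'a \<Rightarrow> 'a \<Rightarrow> real"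
  assumes "Metric_space X d"
  shows "(\<forall>W. openin (locally_finite_topology (Metric_space.mtopology X d)) W
              \<longrightarrow> openin (Metric_space.hausdorff_topology X d) W)
     \<longleftrightarrow> (\<forall>A. closedin (Metric_space.mtopology X d) A \<and> A \<noteq> {} \<longrightarrow> Metric_space.property_I X d A)"
proof -
  interpret Metric_space X d by (rule assms)
  show ?thesis
    unfolding openin_locally_finite_topology_subset_iff
  proof (intro iffI conjI allI impI; (elim conjE)?)
    fix A assume "\<forall>U. openin mtopology U \<longrightarrow> openin hausdorff_topology (hyper_upper mtopology U)"
      and "closedin mtopology A" "A \<noteq> {}"
    then show "property_I A" by (intro property_I_if_hyper_upper_open) simp_all
  next
    assume I: "\<forall>A. closedin mtopology A \<and> A \<noteq> {} \<longrightarrow> property_I A"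
    show "openin hausdorff_topology (hyper_upper mtopology U)" if "openin mtopology U" for U
      using that I by (intro hyper_upper_open_if_property_I) simp_all
    show "openin hausdorff_topology (hyper_lower mtopology \<U>)"
      if "locally_finite_in mtopology \<U>" "\<forall>U\<in>\<U>. openin mtopology U \<and> U \<noteq> {}" for \<U>
      using that I by (intro hyper_lower_open_if_property_I) simp_all
  qed
qed

end
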